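(* There exist finite sample spaces $\Omega^1,\Omega^2,\Omega^3,\Omega^4$ and probability mass functions $p^{1,2,4}$ on $\Omega^1\times\Omega^2\times\Omega^4$, $p^{1,3,4}$ on $\Omega^1\times\Omega^3\times\Omega^4$, and $p^{2,3,4}$ on $\Omega^2\times\Omega^3\times\Omega^4$ that are compatible with each other, such that there is no probability mass function $r^{1,2,3,4}$ on $\Omega^1\times\Omega^2\times\Omega^3\times\Omega^4$ that is compatible with them (i.e. no $r^{1,2,3,4}$ whose marginals over $\Omega^1\times\Omega^2\times\Omega^4$, $\Omega^1\times\Omega^3\times\Omega^4$ and $\Omega^2\times\Omega^3\times\Omega^4$ are $p^{1,2,4}$, $p^{1,3,4}$ and $p^{2,3,4}$, respectively).
   Context: A set of mass functions, each defined on a product of some of the spaces $\Omega^i$, is called compatible if, whenever two of them both have a marginal over the same product of a subset of the spaces, these marginals are equal. For instance, $p^{1,2,4}$ and $p^{1,3,4}$ being compatible means that they have the same marginal over $\Omega^1\times\Omega^4$ (and hence also over $\Omega^1$ and over $\Omega^4$). *)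

theory Defs
  imports "HOL-Probability.Probability_Mass_Function"
begin

text \<open>
  A point of the product of the spaces \<open>\<Omega> i\<close>, \<open>i \<in> I\<close>, is an extensional function on \<open>I\<close>.
  A mass function on the product is a \<open>pmf\<close> whose support lies in it.
\<close>

definition mass_function_on :: "('i \<Rightarrow> 'a set) \<Rightarrow> 'i set \<Rightarrow> ('i \<Rightarrow> 'a) pmf \<Rightarrow> bool" where
  "mass_function_on \<Omega> I p \<longleftrightarrow> set_pmf p \<subseteq> (\<Pi>\<^sub>E i\<in>I. \<Omega> i)"

definition marginal :: "'i set \<Rightarrow> ('i \<Rightarrow> 'a) pmf \<Rightarrow> ('i \<Rightarrow> 'a) pmf" where
  "marginal J p = map_pmf (\<lambda>x. restrict x J) p"

text \<open>
  Each mass function is paired with its index set \<open>I\<close>; it has a marginal over the spaces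
  indexed by \<open>J\<close> exactly when \<open>J \<subseteq> I\<close>.
\<close>

definition compatible :: "('i set \<times> ('i \<Rightarrow> 'a) pmf) set \<Rightarrow> bool" where
  "compatible S \<longleftrightarrow>
    (\<forall>(I, p)\<in>S. \<forall>(K, q)\<in>S. \<forall>J. J \<subseteq> I \<and> J \<subseteq> K \<longrightarrow> marginal J p = marginal J q)"

lemma pmf_marginal:
  "pmf (marginal J p) y = measure_pmf.prob p {x. restrict x J = y}"
  by (simp add: marginal_def pmf_map vimage_def)

lemma marginal_marginal: "J \<subseteq> I \<Longrightarrow> marginal J (marginal I p) = marginal J p"
  by (simp add: marginal_def map_pmf_comp Int_absorb1)

lemma marginal_self: "mass_function_on \<Omega> I p \<Longrightarrow> marginal I p = p"
  unfolding marginal_def mass_function_on_def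
  by (rule map_pmf_idI) (auto dest: PiE_restrict)

text \<open>
  Compatibility of a joint mass function with given ones means that it has them as marginals.
\<close>

lemma compatible_insert_joint_iff:
  assumes "\<And>I p. (I, p) \<in> S \<Longrightarrow> mass_function_on \<Omega> I p \<and> I \<subseteq> L"
  shows "compatible (insert (L, r) S) \<longleftrightarrow> (\<forall>(I, p)\<in>S. marginal I r = p)"
proof
  assume c: "compatible (insert (L, r) S)"
  show "\<forall>(I, p)\<in>S. marginal I r = p"
  proof clarify
    fix I p assume Ip: "(I, p) \<in> S"
    then have "marginal I r = marginal I p"
      using c assms[OF Ip] by (auto simp: compatible_def)
    then show "marginal I r = p"
      using marginal_self assms[OF Ip] by auto
  qed
next
  assume m: "\<forall>(I, p)\<in>S. marginal I r = p"
  have *: "marginal J p = marginal J r" if "(I, p) \<in> insert (L, r) S" "J \<subseteq> I" for I J p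
    using that m marginal_marginal[of J I r] by auto
  show "compatible (insert (L, r) S)"
    unfolding compatible_def by (clarsimp simp only: case_prod_beta) (simp add: *)
qed

end

theory Submission
  imports Defs
begin

text \<open>
  Keep the fourth coordinate constantly 0 and prescribe the joint laws of each two of three fair
  bits: almost surely \<open>x\<^sub>1 = x\<^sub>2\<close>, almost surely \<open>x\<^sub>1 = x\<^sub>3\<close>, and almost surely \<open>x\<^sub>2 \<noteq> x\<^sub>3\<close>. Every single bit
  is uniform in each law, so the laws are compatible, but no point satisfies all three
  constraints, and hence a joint mass function would have empty support.
\<close>

text \<open>One fair bit \<open>b\<close> drives the whole law. The parameter \<open>g\<close>
  covers both kinds of link: the identity forces equal bits, the flip forces different ones.\<close>

definition linked_bits :: "nat \<Rightarrow> nat \<Rightarrow> (nat \<Rightarrow> nat) \<Rightarrow> (nat \<Rightarrow> nat) pmf" where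
  "linked_bits i j g =
    map_pmf (\<lambda>b. \<lambda>k\<in>{i, j, 4}. if k = 4 then 0 else if k = i then b else g b) (pmf_of_set {0, 1})"

lemma set_pmf_linked_bits:
  "set_pmf (linked_bits i j g) =
    (\<lambda>b. \<lambda>k\<in>{i, j, 4}. if k = 4 then 0 else if k = i then b else g b) ` {0, 1}"
  by (simp add: linked_bits_def)

lemma linked_bits_eq:
  assumes "y \<in> set_pmf (linked_bits i j g)" "i \<noteq> j" "i \<noteq> 4" "j \<noteq> 4"
  shows "y j = g (y i)" "y i \<in> {0, 1}"
  using assms by (auto simp: set_pmf_linked_bits)

lemma mass_function_on_linked_bits:
  assumes "bij_betw g {0, 1} {0, 1}"
  shows "mass_function_on (\<lambda>_. {0, 1}) {i, j, 4} (linked_bits i j g)"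
  using bij_betwE[OF assms] by (auto simp: mass_function_on_def set_pmf_linked_bits)

text \<open>Once \<open>i\<close> or \<open>j\<close> is dropped, the link is invisible: at most one
  bit remains, \<open>b\<close> or \<open>g b\<close>, and both are uniform. Since the right-hand
  side mentions none of \<open>i\<close>, \<open>j\<close>, \<open>g\<close>, marginals of different
  laws can be compared.\<close>

lemma marginal_linked_bits:
  assumes g: "bij_betw g {0, 1} {0, 1}" and J: "J \<subseteq> {i, j, 4}" and miss: "i \<notin> J \<or> j \<notin> J"
  shows "marginal J (linked_bits i j g) =
    map_pmf (\<lambda>b. \<lambda>k\<in>J. if k = 4 then 0 else b) (pmf_of_set {0, 1})"
proof (cases "j \<in> J")
  case False
  have "restrict (\<lambda>k\<in>{i, j, 4}. if k = 4 then 0 else if k = i then b else g b) J =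
      (\<lambda>k\<in>J. if k = 4 then 0 else b)" for b :: nat
    using J False by (auto simp: restrict_def fun_eq_iff)
  then show ?thesis
    by (simp add: marginal_def linked_bits_def map_pmf_comp)
next
  case True
  then have i: "i \<notin> J"
    using miss by blast
  have "restrict (\<lambda>k\<in>{i, j, 4}. if k = 4 then 0 else if k = i then b else g b) J =
      (\<lambda>k\<in>J. if k = 4 then 0 else g b)" for b :: nat
    using J i by (auto simp: restrict_def fun_eq_iff)
  then have "marginal J (linked_bits i j g) =
      map_pmf (\<lambda>b. \<lambda>k\<in>J. if k = 4 then 0 else b) (map_pmf g (pmf_of_set {0, 1}))"
    by (simp add: marginal_def linked_bits_def map_pmf_comp)
  \<comment> \<open>A permutation of the two values preserves the uniform law.\<close>
  moreover have "map_pmf g (pmf_of_set {0, 1}) = pmf_of_set {0, 1}"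
    using g by (subst map_pmf_of_set_inj) (auto simp: bij_betw_def)
  ultimately show ?thesis
    by simp
qed

theorem theorem1:
  "\<exists>(\<Omega> :: nat \<Rightarrow> nat set) p124 p134 p234.
     (\<forall>i\<in>{1, 2, 3, 4}. finite (\<Omega> i)) \<and>
     mass_function_on \<Omega> {1, 2, 4} p124 \<and>
     mass_function_on \<Omega> {1, 3, 4} p134 \<and>
     mass_function_on \<Omega> {2, 3, 4} p234 \<and>
     compatible {({1, 2, 4}, p124), ({1, 3, 4}, p134), ({2, 3, 4}, p234)} \<and>
     \<not> (\<exists>r. mass_function_on \<Omega> {1, 2, 3, 4} r \<and>
          compatible {({1, 2, 3, 4}, r),
            ({1, 2, 4}, p124), ({1, 3, 4}, p134), ({2, 3, 4}, p234)})"
proof -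
  let ?\<Omega> = "\<lambda>_ :: nat. {0, 1 :: nat}"
  \<comment> \<open>On 0 and 1, truncated subtraction from 1 swaps the values.\<close>
  let ?flip = "\<lambda>b :: nat. 1 - b"
  let ?p124 = "linked_bits 1 2 id" and ?p134 = "linked_bits 1 3 id"
    and ?p234 = "linked_bits 2 3 ?flip"
  let ?S = "{({1, 2, 4}, ?p124), ({1, 3, 4}, ?p134), ({2, 3, 4}, ?p234)}"
  have flip: "bij_betw ?flip {0, 1} {0, 1}"
    by (auto simp: bij_betw_def)
  have mass: "mass_function_on ?\<Omega> {1, 2, 4} ?p124" "mass_function_on ?\<Omega> {1, 3, 4} ?p134"
    "mass_function_on ?\<Omega> {2, 3, 4} ?p234"
    using mass_function_on_linked_bits[OF bij_betw_id] mass_function_on_linked_bits[OF flip]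
    by blast+
  have bits: "marginal J p = map_pmf (\<lambda>b. \<lambda>k\<in>J. if k = 4 then 0 else b) (pmf_of_set {0, 1})"
    if "(I, p) \<in> ?S" "(K, q) \<in> ?S" "I \<noteq> K" "J \<subseteq> I" "J \<subseteq> K" for I K J p q
  proof -
    \<comment> \<open>Distinct index triples share just one index besides 4, so \<open>J\<close>
      contains at most one of 1, 2, 3.\<close>
    have "(1 \<notin> J \<or> 2 \<notin> J) \<and> (1 \<notin> J \<or> 3 \<notin> J) \<and> (2 \<notin> J \<or> 3 \<notin> J)"
      using that by auto
    then show ?thesis
      using that(1,4) marginal_linked_bits[OF bij_betw_id, of J] marginal_linked_bits[OF flip, of J]
      by blast
  qed
  have "marginal J p = marginal J q"
    if "(I, p) \<in> ?S" "(K, q) \<in> ?S" "J \<subseteq> I" "J \<subseteq> K" for I K J p q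
  proof (cases "I = K")
    case True
    \<comment> \<open>The index sets are pairwise distinct, so each determines its law in
      \<open>?S\<close>.\<close>
    moreover have "{1, 2, 4} \<noteq> {1, 3, 4 :: nat}" "{1, 2, 4} \<noteq> {2, 3, 4 :: nat}"
      "{1, 3, 4} \<noteq> {2, 3, 4 :: nat}"
      unfolding set_eq_iff insert_iff empty_iff by presburger+
    ultimately have "p = q"
      using that(1,2) by auto
    then show ?thesis
      by simp
  next
    case False
    then show ?thesis
      using bits[of I p K q J] bits[of K q I p J] that by metis
  qed
  then have compat: "compatible ?S"
    unfolding compatible_def by blast
  have no_joint: "\<not> compatible (insert ({1, 2, 3, 4}, r) ?S)" for r
  proof
    assume c: "compatible (insert ({1, 2, 3, 4}, r) ?S)"
    have "mass_function_on ?\<Omega> I p \<and> I \<subseteq> {1, 2, 3, 4}" if "(I, p) \<in> ?S" for I p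
      using that mass by auto
    then have "\<forall>(I, p)\<in>?S. marginal I r = p"
      by (rule compatible_insert_joint_iff[THEN iffD1, OF _ c])
    then have r: "marginal {1, 2, 4} r = ?p124" "marginal {1, 3, 4} r = ?p134"
      "marginal {2, 3, 4} r = ?p234"
      by auto
    \<comment> \<open>Restrictions of a support point of \<open>r\<close> lie in the supports of the
      marginals, so \<open>x\<close> obeys all three links at once.\<close>
    obtain x where "x \<in> set_pmf r"
      using set_pmf_not_empty[of r] by blast
    then have x: "restrict x I \<in> set_pmf (marginal I r)" for I
      by (simp add: marginal_def)
    have "x 2 = x 1"
      using linked_bits_eq(1)[OF x[of "{1, 2, 4}", unfolded r]] by simp
    moreover have "x 3 = x 1"
      using linked_bits_eq(1)[OF x[of "{1, 3, 4}", unfolded r]] by simp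
    moreover have "x 3 = 1 - x 2" "x 2 \<in> {0, 1}"
      using linked_bits_eq[OF x[of "{2, 3, 4}", unfolded r]] by simp_all
    \<comment> \<open>The links make \<open>x 2\<close> equal to its own flip.\<close>
    ultimately show False
      by auto
  qed
  from mass compat no_joint show ?thesis
    by (intro exI[of _ ?\<Omega>] exI[of _ ?p124] exI[of _ ?p134] exI[of _ ?p234]) simp
qed

end
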